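(* Let $(M,F)$ be an AR-Finsler manifold of dimension $n\geq 2$, with $g_{ij}=\eta\,a_{ij}$, such that the function $\eta$ is not rational in $y$ and the functions $\partial_i\log(\eta(x,y))$ are rational in $y$. If $F$ is an Einstein metric, then it is Ricci-flat, i.e. $Ric=0$.
   Context: $M$ is a smooth $n$-dimensional manifold with local coordinates $(x^i)$ and induced fibre coordinates $(y^i)$ on $TM$; $\partial_i=\partial/\partial x^i$, $\dot{\partial}_i=\partial/\partial y^i$; the summation convention is used. A Finsler metric on $M$ is a map $F:TM\to[0,\infty)$ which is $C^\infty$ on $TM\setminus\{0\}$, positively homogeneous of degree one in $y$, and such that $g_{ij}(x,y):=\frac12\dot{\partial}_i\dot{\partial}_jF^2$ is positive definite at each point of $TM\setminus\{0\}$; $(g^{ij})$ is the inverse matrix. "Rational in $y$" means: a quotient of two polynomials in the fibre coordinates $y$ whose coefficients are (smooth) functions of $x$. $F$ is an AR-Finsler (Almost Rational Finsler) metric, and $(M,F)$ an AR-Finsler manifold, if $g_{ij}(x,y)=\eta(x,y)\,a_{ij}(x,y)$ where (a) $\eta:TM\setminus\{0\}\to[0,\infty)$ is smooth; (b) $(a_{ij}(x,y))$ is a symmetric positive definite matrix with each $a_{ij}$ rational in $y$; (c) each product $\eta\,a_{ij}$ is positively homogeneous of degree zero in $y$. Spray coefficients: $G^i=\frac14 g^{ir}\left(y^k\dot{\partial}_r\partial_kF^2-\partial_rF^2\right)$. Riemann curvature: $R^i_k=2\partial_kG^i-y^j\partial_j\dot{\partial}_kG^i+2G^j\dot{\partial}_k\dot{\partial}_jG^i-\dot{\partial}_jG^i\,\dot{\partial}_kG^j$;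 $Ric=R^m_m$. $F$ is an Einstein metric if $Ric=(n-1)\,K\,F^2$ for some $K\in C^\infty(M)$.
   Formalization: "η is not rational in y" is taken to mean that η is rational in y over no nonempty open set of any coordinate domain; if η may be rational over part of M, the claim fails (e.g. a round sphere together with a disjoint non-Riemannian Minkowski plane). *)

theory Defs
  imports "HOL-Analysis.Analysis"
begin

subsection \<open>Smooth maps on open subsets of Euclidean space\<close>

primrec Ck_on :: "nat \<Rightarrow> 'a::euclidean_space set \<Rightarrow> ('a \<Rightarrow> 'b::real_normed_vector) \<Rightarrow> bool" where
  "Ck_on 0 S f \<longleftrightarrow> continuous_on S f"
| "Ck_on (Suc k) S f \<longleftrightarrow> (\<forall>x\<in>S. f differentiable (at x)) \<and>
     (\<forall>v. Ck_on k S (\<lambda>x. frechet_derivative f (at x) v))"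

text \<open>Only meant for open \<open>S\<close>: the derivatives are taken at \<open>x\<close>, not within \<open>S\<close>.\<close>

definition smooth_on :: "'a::euclidean_space set \<Rightarrow> ('a \<Rightarrow> 'b::real_normed_vector) \<Rightarrow> bool" where
  "smooth_on S f \<longleftrightarrow> (\<forall>k. Ck_on k S f)"


subsection \<open>Smooth manifolds\<close>

text \<open>A manifold of dimension \<open>CARD('n)\<close> is a Hausdorff, second countable type \<open>'a\<close>
  together with a smooth atlas, which need not be maximal. The values of a chart map outside the
  chart domain are irrelevant.\<close>

type_synonym ('a, 'n) chart = "'a set \<times> ('a \<Rightarrow> real ^ 'n)"

definition chart_dom :: "('a, 'n) chart \<Rightarrow> 'a set" where
  "chart_dom c = fst c"

definition chart_map :: "('a, 'n) chart \<Rightarrow> 'a \<Rightarrow> real ^ 'n" where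
  "chart_map c = snd c"

definition chart_img :: "('a, 'n) chart \<Rightarrow> (real ^ 'n) set" where
  "chart_img c = chart_map c ` chart_dom c"

definition chart_inv :: "('a, 'n) chart \<Rightarrow> real ^ 'n \<Rightarrow> 'a" where
  "chart_inv c = inv_into (chart_dom c) (chart_map c)"

definition smooth_atlas ::
    "('a::{t2_space, second_countable_topology}, 'n::finite) chart set \<Rightarrow> bool" where
  "smooth_atlas A \<longleftrightarrow>
     (\<forall>c\<in>A. open (chart_dom c) \<and> open (chart_img c) \<and>
        homeomorphism (chart_dom c) (chart_img c) (chart_map c) (chart_inv c)) \<and>
     (\<Union>c\<in>A. chart_dom c) = UNIV \<and>
     (\<forall>c\<in>A. \<forall>d\<in>A. smooth_on (chart_map c ` (chart_dom c \<inter> chart_dom d))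
                                 (chart_map d \<circ> chart_inv c))"

definition smooth_function ::
    "('a::{t2_space, second_countable_topology}, 'n::finite) chart set \<Rightarrow> ('a \<Rightarrow> real) \<Rightarrow> bool" where
  "smooth_function A K \<longleftrightarrow> (\<forall>c\<in>A. smooth_on (chart_img c) (K \<circ> chart_inv c))"


subsection \<open>The tangent bundle\<close>

text \<open>A tangent vector is a base point together with the family of its components in all charts
  around that point; components in different charts are related by the Jacobian of the
  transition map. The family is \<open>0\<close> at charts that do not contain the base point, so that equal
  vectors are equal as HOL values.\<close>

type_synonym ('a, 'n) tvec = "'a \<times> (('a, 'n) chart \<Rightarrow> real ^ 'n)"

definition tangent_vector ::
    "('a, 'n::finite) chart set \<Rightarrow> ('a, 'n) chart \<Rightarrow> real ^ 'n \<Rightarrow> real ^ 'n \<Rightarrow> ('a, 'n) tvec" where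
  "tangent_vector A c x y =
     (chart_inv c x,
      \<lambda>d. if d \<in> A \<and> chart_inv c x \<in> chart_dom d
          then frechet_derivative (chart_map d \<circ> chart_inv c) (at x) y else 0)"

text \<open>\<open>tangent_vector A c x y\<close> is the vector with induced coordinates \<open>(x, y)\<close> in the chart \<open>c\<close>.
  The induced coordinates change in the usual way, so functions on such vectors are
  functions on \<open>TM\<close> independent of coordinates:\<close>

lemma tangent_vector_change_chart:
  fixes A :: "('a::{t2_space, second_countable_topology}, 'n::finite) chart set"
  assumes A: "smooth_atlas A" and c: "c \<in> A" and d: "d \<in> A"
    and x: "x \<in> chart_img c" and xd: "chart_inv c x \<in> chart_dom d"
  shows "tangent_vector A c x y =
    tangent_vector A d (chart_map d (chart_inv c x))
      (frechet_derivative (chart_map d \<circ> chart_inv c) (at x) y)"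
proof -
  have inv: "chart_inv e (chart_map e p) = p" if "e \<in> A" "p \<in> chart_dom e" for e p
    using A that unfolding smooth_atlas_def homeomorphism_def by blast
  define p where "p = chart_inv c x"
  have pc: "p \<in> chart_dom c" and xp: "x = chart_map c p"
    using x inv[OF c] unfolding p_def chart_img_def by auto
  have pd: "p \<in> chart_dom d" using xd p_def by simp
  have op: "open (chart_map e ` (chart_dom e \<inter> chart_dom f))" if "e \<in> A" "f \<in> A" for e f
  proof -
    have h: "homeomorphism (chart_dom e) (chart_img e) (chart_map e) (chart_inv e)"
      and oi: "open (chart_img e)" and of: "open (chart_dom f)"
      using A that unfolding smooth_atlas_def by auto
    have "openin (top_of_set (chart_dom e)) (chart_dom e \<inter> chart_dom f)"
      using of by (simp add: openin_open_Int)
    then have "openin (top_of_set (chart_img e)) (chart_map e ` (chart_dom e \<inter> chart_dom f))"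
      using homeomorphism_imp_open_map[OF h] by blast
    then show ?thesis using oi openin_open_trans by blast
  qed
  have diff: "(chart_map f \<circ> chart_inv e) differentiable (at (chart_map e q))"
    if "e \<in> A" "f \<in> A" "q \<in> chart_dom e" "q \<in> chart_dom f" for e f q
  proof -
    have "Ck_on (Suc 0) (chart_map e ` (chart_dom e \<inter> chart_dom f)) (chart_map f \<circ> chart_inv e)"
      using A that unfolding smooth_atlas_def smooth_on_def by blast
    then show ?thesis using that by auto
  qed
  have "frechet_derivative (chart_map e \<circ> chart_inv c) (at x) y =
        frechet_derivative (chart_map e \<circ> chart_inv d) (at (chart_map d p))
          (frechet_derivative (chart_map d \<circ> chart_inv c) (at x) y)"
    if e: "e \<in> A" and pe: "p \<in> chart_dom e" for e
  proof -
    let ?f = "chart_map d \<circ> chart_inv c" and ?g = "chart_map e \<circ> chart_inv d"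
    have fx: "?f x = chart_map d p" by (simp add: p_def)
    have f: "(?f has_derivative frechet_derivative ?f (at x)) (at x)"
      using diff[OF c d pc pd] unfolding xp by (simp only: frechet_derivative_works)
    have g: "(?g has_derivative frechet_derivative ?g (at (chart_map d p))) (at (?f x))"
      using diff[OF d e pd pe] unfolding fx by (simp only: frechet_derivative_works)
    have "((?g \<circ> ?f) has_derivative
        frechet_derivative ?g (at (chart_map d p)) \<circ> frechet_derivative ?f (at x)) (at x)"
      using diff_chain_at[OF f g] .
    then have "((chart_map e \<circ> chart_inv c) has_derivative
        frechet_derivative ?g (at (chart_map d p)) \<circ> frechet_derivative ?f (at x)) (at x)"
    proof (rule has_derivative_transform_within_open[OF _ op[OF c d]])
      show "x \<in> chart_map c ` (chart_dom c \<inter> chart_dom d)"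
        unfolding xp using pc pd by (intro imageI IntI)
    qed (auto simp: inv[OF c] inv[OF d])
    then have "frechet_derivative (chart_map e \<circ> chart_inv c) (at x) =
        frechet_derivative ?g (at (chart_map d p)) \<circ> frechet_derivative ?f (at x)"
      by (rule frechet_derivative_at[symmetric])
    then show ?thesis by simp
  qed
  moreover have "chart_inv d (chart_map d p) = p"
    using inv[OF d pd] .
  ultimately show ?thesis
    unfolding tangent_vector_def p_def[symmetric] by (auto simp: fun_eq_iff)
qed

text \<open>The coordinate expression of a function on \<open>TM\<close>.\<close>

definition in_chart ::
    "('a, 'n::finite) chart set \<Rightarrow> ('a, 'n) chart \<Rightarrow> (('a, 'n) tvec \<Rightarrow> real) \<Rightarrow>
      (real ^ 'n) \<times> (real ^ 'n) \<Rightarrow> real" where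
  "in_chart A c f = (\<lambda>(x, y). f (tangent_vector A c x y))"

definition slit :: "(real ^ 'n::finite) set \<Rightarrow> ((real ^ 'n) \<times> (real ^ 'n)) set" where
  "slit V = V \<times> (UNIV - {0})"

text \<open>Partial derivatives \<open>\<partial>/\<partial>x\<^sup>i\<close> and \<open>\<partial>/\<partial>y\<^sup>i\<close>, taken through the total derivative; they are
  applied only to functions that are smooth on the slit bundle.\<close>

definition dx :: "'n::finite \<Rightarrow> ((real ^ 'n) \<times> (real ^ 'n) \<Rightarrow> real) \<Rightarrow> (real ^ 'n) \<times> (real ^ 'n) \<Rightarrow> real" where
  "dx i f z = frechet_derivative f (at z) (axis i 1, 0)"

definition dy :: "'n::finite \<Rightarrow> ((real ^ 'n) \<times> (real ^ 'n) \<Rightarrow> real) \<Rightarrow> (real ^ 'n) \<times> (real ^ 'n) \<Rightarrow> real" where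
  "dy i f z = frechet_derivative f (at z) (0, axis i 1)"


subsection \<open>Functions rational in the fibre coordinates\<close>

definition polynomial_in_y ::
    "(real ^ 'n::finite) set \<Rightarrow> ((real ^ 'n) \<times> (real ^ 'n) \<Rightarrow> real) \<Rightarrow> bool" where
  "polynomial_in_y V P \<longleftrightarrow>
     (\<exists>(I :: ('n \<Rightarrow> nat) set) c. finite I \<and> (\<forall>m\<in>I. smooth_on V (c m)) \<and>
        (\<forall>x\<in>V. \<forall>y. P (x, y) = (\<Sum>m\<in>I. c m x * (\<Prod>i\<in>UNIV. (y $ i) ^ m i))))"

text \<open>Equality of functions on the slit tangent bundle over \<open>V\<close>, so the denominator has
  no zeros there.\<close>

definition rational_in_y ::
    "(real ^ 'n::finite) set \<Rightarrow> ((real ^ 'n) \<times> (real ^ 'n) \<Rightarrow> real) \<Rightarrow> bool" where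
  "rational_in_y V f \<longleftrightarrow>
     (\<exists>P Q. polynomial_in_y V P \<and> polynomial_in_y V Q \<and>
        (\<forall>z\<in>slit V. Q z \<noteq> 0 \<and> f z = P z / Q z))"


subsection \<open>Finsler metrics\<close>

definition pos_def :: "real ^ 'n ^ 'n::finite \<Rightarrow> bool" where
  "pos_def B \<longleftrightarrow> transpose B = B \<and> (\<forall>v. v \<noteq> 0 \<longrightarrow> v \<bullet> (B *v v) > 0)"

text \<open>From here to \<open>Ric\<close>, \<open>F\<close> is the coordinate expression of the metric in a single chart.\<close>

definition metric_tensor ::
    "((real ^ 'n::finite) \<times> (real ^ 'n) \<Rightarrow> real) \<Rightarrow> (real ^ 'n) \<times> (real ^ 'n) \<Rightarrow> real ^ 'n ^ 'n" where
  "metric_tensor F z = (\<chi> i j. 1 / 2 * dy i (dy j (\<lambda>w. (F w)\<^sup>2)) z)"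

definition spray ::
    "((real ^ 'n::finite) \<times> (real ^ 'n) \<Rightarrow> real) \<Rightarrow> 'n \<Rightarrow> (real ^ 'n) \<times> (real ^ 'n) \<Rightarrow> real" where
  "spray F i z = 1 / 4 * (\<Sum>r\<in>UNIV. matrix_inv (metric_tensor F z) $ i $ r *
     ((\<Sum>k\<in>UNIV. snd z $ k * dy r (dx k (\<lambda>w. (F w)\<^sup>2)) z) - dx r (\<lambda>w. (F w)\<^sup>2) z))"

definition riemann_curvature ::
    "((real ^ 'n::finite) \<times> (real ^ 'n) \<Rightarrow> real) \<Rightarrow> 'n \<Rightarrow> 'n \<Rightarrow> (real ^ 'n) \<times> (real ^ 'n) \<Rightarrow> real" where
  "riemann_curvature F i k z =
     2 * dx k (spray F i) z
     - (\<Sum>j\<in>UNIV. snd z $ j * dx j (dy k (spray F i)) z)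
     + 2 * (\<Sum>j\<in>UNIV. spray F j z * dy k (dy j (spray F i)) z)
     - (\<Sum>j\<in>UNIV. dy j (spray F i) z * dy k (spray F j) z)"

definition Ric ::
    "((real ^ 'n::finite) \<times> (real ^ 'n) \<Rightarrow> real) \<Rightarrow> (real ^ 'n) \<times> (real ^ 'n) \<Rightarrow> real" where
  "Ric F z = (\<Sum>m\<in>UNIV. riemann_curvature F m m z)"

definition finsler_metric ::
    "('a::{t2_space, second_countable_topology}, 'n::finite) chart set \<Rightarrow>
      (('a, 'n) tvec \<Rightarrow> real) \<Rightarrow> bool" where
  "finsler_metric A F \<longleftrightarrow> (\<forall>c\<in>A.
     (\<forall>x\<in>chart_img c. \<forall>y. in_chart A c F (x, y) \<ge> 0) \<and>
     smooth_on (slit (chart_img c)) (in_chart A c F) \<and>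
     (\<forall>x\<in>chart_img c. \<forall>y. \<forall>t>0. in_chart A c F (x, t *\<^sub>R y) = t * in_chart A c F (x, y)) \<and>
     (\<forall>z\<in>slit (chart_img c). pos_def (metric_tensor (in_chart A c F) z)))"

text \<open>\<open>\<eta>\<close> is a function on the slit tangent bundle; the matrix \<open>a\<close> is given in every chart.\<close>

definition AR_finsler ::
    "('a::{t2_space, second_countable_topology}, 'n::finite) chart set \<Rightarrow>
      (('a, 'n) tvec \<Rightarrow> real) \<Rightarrow> (('a, 'n) tvec \<Rightarrow> real) \<Rightarrow>
      (('a, 'n) chart \<Rightarrow> (real ^ 'n) \<times> (real ^ 'n) \<Rightarrow> real ^ 'n ^ 'n) \<Rightarrow> bool" where
  "AR_finsler A F \<eta> a \<longleftrightarrow> finsler_metric A F \<and> (\<forall>c\<in>A.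
     (\<forall>z\<in>slit (chart_img c).
        metric_tensor (in_chart A c F) z = in_chart A c \<eta> z *\<^sub>R a c z) \<and>
     smooth_on (slit (chart_img c)) (in_chart A c \<eta>) \<and>
     (\<forall>z\<in>slit (chart_img c). in_chart A c \<eta> z \<ge> 0) \<and>
     (\<forall>z\<in>slit (chart_img c). pos_def (a c z)) \<and>
     (\<forall>i j. rational_in_y (chart_img c) (\<lambda>z. a c z $ i $ j)) \<and>
     (\<forall>i j. \<forall>(x, y)\<in>slit (chart_img c). \<forall>t>0.
        in_chart A c \<eta> (x, t *\<^sub>R y) * a c (x, t *\<^sub>R y) $ i $ j =
        in_chart A c \<eta> (x, y) * a c (x, y) $ i $ j))"

definition einstein ::
    "('a::{t2_space, second_countable_topology}, 'n::finite) chart set \<Rightarrow>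
      (('a, 'n) tvec \<Rightarrow> real) \<Rightarrow> bool" where
  "einstein A F \<longleftrightarrow> (\<exists>K. smooth_function A K \<and>
     (\<forall>c\<in>A. \<forall>z\<in>slit (chart_img c).
        Ric (in_chart A c F) z =
          (real CARD('n) - 1) * K (chart_inv c (fst z)) * (in_chart A c F z)\<^sup>2))"

definition ricci_flat ::
    "('a::{t2_space, second_countable_topology}, 'n::finite) chart set \<Rightarrow>
      (('a, 'n) tvec \<Rightarrow> real) \<Rightarrow> bool" where
  "ricci_flat A F \<longleftrightarrow>
     (\<forall>c\<in>A. \<forall>z\<in>slit (chart_img c). Ric (in_chart A c F) z = 0)"

text \<open>Rationality of a function on \<open>TM\<close> is a property of its coordinate expression over a coordinate
  domain. Any open subset of a chart domain is again a coordinate domain, so a function that is not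
  rational in \<open>y\<close> in local coordinates is one that is not rational over any nonempty open set. This
  cannot be weakened to failure of rationality in some chart of \<open>A\<close>: in a disjoint union the
  function could be rational over one component and not over another.\<close>

definition nowhere_rational_in_y ::
    "('a::{t2_space, second_countable_topology}, 'n::finite) chart set \<Rightarrow>
      (('a, 'n) tvec \<Rightarrow> real) \<Rightarrow> bool" where
  "nowhere_rational_in_y A f \<longleftrightarrow>
     (\<forall>c\<in>A. \<forall>V. open V \<and> V \<noteq> {} \<and> V \<subseteq> chart_img c \<longrightarrow> \<not> rational_in_y V (in_chart A c f))"

end

theory Submission
  imports Defs
begin

text \<open>By Euler's theorem \<open>F\<^sup>2 = \<eta> a\<^sub>i\<^sub>j y\<^sup>i y\<^sup>j\<close> and \<open>\<partial>F\<^sup>2/\<partial>y\<^sup>j = 2 \<eta> a\<^sub>i\<^sub>j y\<^sup>i\<close>, so the fibre derivatives of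
  \<open>log \<eta>\<close> are rational in \<open>y\<close>; the base derivatives are rational by assumption. Hence every
  derivative of \<open>F\<^sup>2\<close> is \<open>\<eta>\<close> times a rational function. The factor \<open>\<eta>\<close> cancels in the spray
  coefficients, so these and the Ricci curvature are rational in \<open>y\<close>. If the Einstein function
  \<open>K\<close> were nonzero at a point, it would be nonzero near that point, and
  \<open>\<eta> = Ric / ((n - 1) K a\<^sub>i\<^sub>j y\<^sup>i y\<^sup>j)\<close> would be rational there.\<close>

subsection \<open>Smooth functions\<close>

text \<open>Since \<open>f\<close> and \<open>g\<close> admit exactly the same derivatives
  \<open>D\<close> at \<open>x\<close>, the choice operator behind \<open>frechet_derivative\<close>
  picks the same map for both, even where no derivative exists.\<close>

lemma frechet_derivative_cong_open:
  assumes "open S" "x \<in> S" "\<And>y. y \<in> S \<Longrightarrow> f y = g y"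
  shows "frechet_derivative f (at x) = frechet_derivative g (at x)"
proof -
  have "(f has_derivative D) (at x) \<longleftrightarrow> (g has_derivative D) (at x)" for D
    using has_derivative_transform_within_open[OF _ assms(1,2), of f D UNIV g]
      has_derivative_transform_within_open[OF _ assms(1,2), of g D UNIV f] assms(3) by auto
  then show ?thesis by (simp add: frechet_derivative_def)
qed

lemma differentiable_cong_open:
  assumes "open S" "x \<in> S" "\<And>y. y \<in> S \<Longrightarrow> f y = g y" "g differentiable (at x)"
  shows "f differentiable (at x)"
proof -
  obtain D where "(g has_derivative D) (at x)" using assms(4) unfolding differentiable_def by blast
  then have "(f has_derivative D) (at x)"
    by (rule has_derivative_transform_within_open[OF _ assms(1,2)]) (simp add: assms(3))
  then show ?thesis unfolding differentiable_def by blast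
qed

text \<open>Derivatives in \<open>Ck_on\<close> are taken at \<open>x\<close>, not within
  \<open>S\<close>; openness of \<open>S\<close> lets agreement on \<open>S\<close> pass to
  them.\<close>

lemma Ck_on_cong:
  assumes "open S" "\<And>x. x \<in> S \<Longrightarrow> f x = g x" "Ck_on k S g"
  shows "Ck_on k S f"
  using assms(2,3)
proof (induction k arbitrary: f g)
  case 0
  then show ?case using continuous_on_cong[of S S f g] by simp
next
  case (Suc k)
  have "f differentiable (at x)" if "x \<in> S" for x
    using differentiable_cong_open[OF assms(1) that Suc.prems(1)] Suc.prems(2) that by simp
  moreover have "Ck_on k S (\<lambda>x. frechet_derivative f (at x) v)" for v
  proof (rule Suc.IH)
    show "Ck_on k S (\<lambda>x. frechet_derivative g (at x) v)" using Suc.prems(2) by simp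
    show "frechet_derivative f (at x) v = frechet_derivative g (at x) v" if "x \<in> S" for x
      using frechet_derivative_cong_open[OF assms(1) that Suc.prems(1)] by simp
  qed
  ultimately show ?case by simp
qed

lemma Ck_on_SucD: "Ck_on (Suc k) S f \<Longrightarrow> Ck_on k S f"
proof (induction k arbitrary: f)
  case 0
  then show ?case
    by (simp add: continuous_at_imp_continuous_on differentiable_imp_continuous_within)
next
  case (Suc k)
  then have "Ck_on (Suc k) S (\<lambda>x. frechet_derivative f (at x) v)" for v
    by (subst (asm) Ck_on.simps(2)) blast
  then show ?case using Suc by simp
qed

lemma Ck_on_subset: "Ck_on k S f \<Longrightarrow> T \<subseteq> S \<Longrightarrow> Ck_on k T f"
  by (induction k arbitrary: f) (auto intro: continuous_on_subset)

lemma Ck_on_const: "Ck_on k S (\<lambda>x. c)"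
  by (induction k arbitrary: c) auto

lemma frechet_derivative_add_apply:
  assumes "f differentiable (at x)" "g differentiable (at x)"
  shows "frechet_derivative (\<lambda>x. f x + g x) (at x) v =
    frechet_derivative f (at x) v + frechet_derivative g (at x) v"
  using frechet_derivative_at[OF has_derivative_add[OF assms[unfolded frechet_derivative_works]]]
  by metis

lemma frechet_derivative_mult_apply:
  fixes f g :: "'a::real_normed_vector \<Rightarrow> real"
  assumes "f differentiable (at x)" "g differentiable (at x)"
  shows "frechet_derivative (\<lambda>x. f x * g x) (at x) v =
    f x * frechet_derivative g (at x) v + frechet_derivative f (at x) v * g x"
  using frechet_derivative_at[OF has_derivative_mult[OF assms[unfolded frechet_derivative_works]]]
  by metis

lemma Ck_on_add:
  assumes "open S" "Ck_on k S f" "Ck_on k S g"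
  shows "Ck_on k S (\<lambda>x. f x + g x)"
  using assms(2,3)
proof (induction k arbitrary: f g)
  case 0
  then show ?case by (simp add: continuous_on_add)
next
  case (Suc k)
  have "Ck_on k S (\<lambda>x. frechet_derivative (\<lambda>x. f x + g x) (at x) v)" for v
  proof (rule Ck_on_cong[OF assms(1)])
    show "Ck_on k S (\<lambda>x. frechet_derivative f (at x) v + frechet_derivative g (at x) v)"
      using Suc by simp
    show "frechet_derivative (\<lambda>x. f x + g x) (at x) v =
        frechet_derivative f (at x) v + frechet_derivative g (at x) v" if "x \<in> S" for x
      using Suc.prems that by (simp add: frechet_derivative_add_apply)
  qed
  then show ?case using Suc.prems by (simp add: differentiable_add)
qed

lemma Ck_on_mult:
  fixes f g :: "'a::euclidean_space \<Rightarrow> real"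
  assumes "open S" "Ck_on k S f" "Ck_on k S g"
  shows "Ck_on k S (\<lambda>x. f x * g x)"
  using assms(2,3)
proof (induction k arbitrary: f g)
  case 0
  then show ?case by (simp add: continuous_on_mult)
next
  case (Suc k)
  have "Ck_on k S (\<lambda>x. frechet_derivative (\<lambda>x. f x * g x) (at x) v)" for v
  proof (rule Ck_on_cong[OF assms(1)])
    \<comment> \<open>The Leibniz rule multiplies a function by a derivative of the other one, which
      is only of class \<open>k\<close>. Both functions are lowered to that class so that the
      induction hypothesis applies.\<close>
    have "Ck_on k S f" "Ck_on k S g" using Suc.prems Ck_on_SucD by blast+
    then show "Ck_on k S (\<lambda>x. f x * frechet_derivative g (at x) v + frechet_derivative f (at x) v * g x)"
      using Suc by (intro Ck_on_add assms(1)) simp_all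
    show "frechet_derivative (\<lambda>x. f x * g x) (at x) v =
        f x * frechet_derivative g (at x) v + frechet_derivative f (at x) v * g x" if "x \<in> S" for x
      using Suc.prems that by (simp add: frechet_derivative_mult_apply)
  qed
  then show ?case using Suc.prems by (simp add: differentiable_mult)
qed

lemma smooth_on_const: "smooth_on S (\<lambda>x. c)"
  by (simp add: smooth_on_def Ck_on_const)

lemma smooth_on_add:
  "open S \<Longrightarrow> smooth_on S f \<Longrightarrow> smooth_on S g \<Longrightarrow> smooth_on S (\<lambda>x. f x + g x)"
  by (simp add: smooth_on_def Ck_on_add)

lemma smooth_on_mult:
  fixes f g :: "'a::euclidean_space \<Rightarrow> real"
  shows "open S \<Longrightarrow> smooth_on S f \<Longrightarrow> smooth_on S g \<Longrightarrow> smooth_on S (\<lambda>x. f x * g x)"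
  by (simp add: smooth_on_def Ck_on_mult)

lemma smooth_on_subset: "smooth_on S f \<Longrightarrow> T \<subseteq> S \<Longrightarrow> smooth_on T f"
  unfolding smooth_on_def using Ck_on_subset by blast

lemma smooth_on_frechet_derivative:
  "smooth_on S f \<Longrightarrow> smooth_on S (\<lambda>x. frechet_derivative f (at x) v)"
  unfolding smooth_on_def by (metis Ck_on.simps(2))

lemma smooth_on_differentiable: "smooth_on S f \<Longrightarrow> x \<in> S \<Longrightarrow> f differentiable (at x)"
  unfolding smooth_on_def by (metis Ck_on.simps(2))

lemma smooth_on_continuous: "smooth_on S f \<Longrightarrow> continuous_on S f"
  unfolding smooth_on_def by (metis Ck_on.simps(1))


subsection \<open>Functions polynomial in the fibre coordinates\<close>

lemma polynomial_in_y_cong: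
  assumes "polynomial_in_y V P" "\<And>z. z \<in> V \<times> UNIV \<Longrightarrow> Q z = P z"
  shows "polynomial_in_y V Q"
proof -
  obtain I c where I: "finite I" "\<forall>m\<in>I. smooth_on V (c m)"
    and "\<forall>x\<in>V. \<forall>y. P (x, y) = (\<Sum>m\<in>I. c m x * (\<Prod>i\<in>UNIV. (y $ i) ^ m i))"
    using assms(1) unfolding polynomial_in_y_def by blast
  then have "\<forall>x\<in>V. \<forall>y. Q (x, y) = (\<Sum>m\<in>I. c m x * (\<Prod>i\<in>UNIV. (y $ i) ^ m i))"
    using assms(2) by simp
  with I show ?thesis unfolding polynomial_in_y_def by blast
qed

lemma polynomial_in_y_monomial:
  assumes "smooth_on V c"
  shows "polynomial_in_y V (\<lambda>z. c (fst z) * (\<Prod>i\<in>UNIV. (snd z $ i) ^ m i))"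
  unfolding polynomial_in_y_def
  by (rule exI[of _ "{m}"], rule exI[of _ "\<lambda>_. c"]) (use assms in simp)

lemma polynomial_in_y_add:
  assumes V: "open V" and P: "polynomial_in_y V P" and Q: "polynomial_in_y V Q"
  shows "polynomial_in_y V (\<lambda>z. P z + Q z)"
proof -
  obtain I c where I: "finite I" "\<forall>m\<in>I. smooth_on V (c m)"
    and Pc: "\<forall>x\<in>V. \<forall>y. P (x, y) = (\<Sum>m\<in>I. c m x * (\<Prod>i\<in>UNIV. (y $ i) ^ m i))"
    using P unfolding polynomial_in_y_def by blast
  obtain J d where J: "finite J" "\<forall>m\<in>J. smooth_on V (d m)"
    and Qd: "\<forall>x\<in>V. \<forall>y. Q (x, y) = (\<Sum>m\<in>J. d m x * (\<Prod>i\<in>UNIV. (y $ i) ^ m i))"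
    using Q unfolding polynomial_in_y_def by blast
  \<comment> \<open>The two index sets may differ, so the coefficients are extended by the smooth
    function zero to \<open>I \<union> J\<close>.\<close>
  define c' where "c' = (\<lambda>m x. if m \<in> I then c m x else 0)"
  define d' where "d' = (\<lambda>m x. if m \<in> J then d m x else 0)"
  have "smooth_on V (c' m)" for m
    using I(2) by (cases "m \<in> I") (auto simp: c'_def smooth_on_const)
  moreover have "smooth_on V (d' m)" for m
    using J(2) by (cases "m \<in> J") (auto simp: d'_def smooth_on_const)
  ultimately have "\<forall>m\<in>I \<union> J. smooth_on V (\<lambda>x. c' m x + d' m x)"
    using smooth_on_add[OF V] by blast
  moreover have "P (x, y) + Q (x, y) =
      (\<Sum>m\<in>I \<union> J. (c' m x + d' m x) * (\<Prod>i\<in>UNIV. (y $ i) ^ m i))" if "x \<in> V" for x y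
  proof -
    have "P (x, y) = (\<Sum>m\<in>I \<union> J. c' m x * (\<Prod>i\<in>UNIV. (y $ i) ^ m i))"
      using Pc that I J by (auto simp: c'_def intro!: sum.mono_neutral_cong_left)
    moreover have "Q (x, y) = (\<Sum>m\<in>I \<union> J. d' m x * (\<Prod>i\<in>UNIV. (y $ i) ^ m i))"
      using Qd that I J by (auto simp: d'_def intro!: sum.mono_neutral_cong_left)
    ultimately show ?thesis by (simp add: sum.distrib distrib_right)
  qed
  ultimately show ?thesis
    unfolding polynomial_in_y_def using I(1) J(1)
    by (intro exI[of _ "I \<union> J"] exI[of _ "\<lambda>m x. c' m x + d' m x"]) auto
qed

lemma polynomial_in_y_coeff:
  assumes "smooth_on V c"
  shows "polynomial_in_y V (\<lambda>z. c (fst z))"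
  using polynomial_in_y_monomial[OF assms, of "\<lambda>_. 0"] by simp

lemma polynomial_in_y_const: "polynomial_in_y V (\<lambda>z. c)"
  using polynomial_in_y_coeff[OF smooth_on_const] .

lemma polynomial_in_y_coord: "polynomial_in_y V (\<lambda>z. snd z $ i)"
proof -
  have "(\<Prod>j\<in>UNIV. (y $ j) ^ (if j = i then 1 else 0)) = y $ i" for y :: "real ^ 'a"
    by (simp add: if_distrib[of "\<lambda>n. _ ^ n"] prod.delta cong: if_cong)
  then show ?thesis
    using polynomial_in_y_monomial[OF smooth_on_const[of V 1], of "\<lambda>j. if j = i then 1 else 0"]
    by simp
qed

lemma polynomial_in_y_sum:
  assumes "open V" "\<And>s. s \<in> S \<Longrightarrow> polynomial_in_y V (P s)"
  shows "polynomial_in_y V (\<lambda>z. \<Sum>s\<in>S. P s z)"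
  using assms(2)
  by (induction S rule: infinite_finite_induct)
    (auto simp: polynomial_in_y_const polynomial_in_y_add[OF assms(1)])

text \<open>The product is expanded over pairs of exponents. Different pairs can have the same sum,
  so the expansion is treated as a sum of polynomials instead of being indexed by its
  exponents.\<close>

lemma polynomial_in_y_mult:
  assumes V: "open V" and P: "polynomial_in_y V P" and Q: "polynomial_in_y V Q"
  shows "polynomial_in_y V (\<lambda>z. P z * Q z)"
proof -
  obtain I c where I: "finite I" "\<forall>m\<in>I. smooth_on V (c m)"
    and Pc: "\<forall>x\<in>V. \<forall>y. P (x, y) = (\<Sum>m\<in>I. c m x * (\<Prod>i\<in>UNIV. (y $ i) ^ m i))"
    using P unfolding polynomial_in_y_def by blast
  obtain J d where J: "finite J" "\<forall>m\<in>J. smooth_on V (d m)"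
    and Qd: "\<forall>x\<in>V. \<forall>y. Q (x, y) = (\<Sum>m\<in>J. d m x * (\<Prod>i\<in>UNIV. (y $ i) ^ m i))"
    using Q unfolding polynomial_in_y_def by blast
  have "polynomial_in_y V (\<lambda>z. \<Sum>m\<in>I. \<Sum>n\<in>J.
      (c m (fst z) * d n (fst z)) * (\<Prod>i\<in>UNIV. (snd z $ i) ^ (m i + n i)))"
    using I J
    by (intro polynomial_in_y_sum V polynomial_in_y_monomial[where c = "\<lambda>x. c _ x * d _ x"]
        smooth_on_mult) auto
  then show ?thesis
  proof (rule polynomial_in_y_cong)
    fix z :: "(real ^ 'a) \<times> (real ^ 'a)"
    assume "z \<in> V \<times> UNIV"
    then show "P z * Q z = (\<Sum>m\<in>I. \<Sum>n\<in>J.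
      (c m (fst z) * d n (fst z)) * (\<Prod>i\<in>UNIV. (snd z $ i) ^ (m i + n i)))"
      using Pc Qd
      by (cases z) (auto simp: sum_product power_add prod.distrib ac_simps intro!: sum.cong)
  qed
qed

text \<open>Smooth coefficients and fibre coordinates generate all polynomials under sums and
  products. The case \<open>cong\<close> is there because \<open>polynomial_in_y\<close> constrains
  a function only over \<open>V\<close>, leaving its values elsewhere arbitrary.\<close>

lemma polynomial_in_y_induct [consumes 2, case_names coeff coord add mult cong]:
  fixes V :: "(real ^ 'n::finite) set"
  assumes V: "open V" and P: "polynomial_in_y V P"
    and coeff: "\<And>c. smooth_on V c \<Longrightarrow> T (\<lambda>z. c (fst z))"
    and coord: "\<And>i. T (\<lambda>z. snd z $ i)"
    and add: "\<And>P Q. T P \<Longrightarrow> T Q \<Longrightarrow> T (\<lambda>z. P z + Q z)"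
    and mult: "\<And>P Q. T P \<Longrightarrow> T Q \<Longrightarrow> T (\<lambda>z. P z * Q z)"
    and cong: "\<And>P Q. T P \<Longrightarrow> (\<And>z. z \<in> V \<times> UNIV \<Longrightarrow> Q z = P z) \<Longrightarrow> T Q"
  shows "T P"
proof -
  obtain I c where I: "finite I" "\<forall>m\<in>I. smooth_on V (c m)"
    and Pc: "\<forall>x\<in>V. \<forall>y. P (x, y) = (\<Sum>m\<in>I. c m x * (\<Prod>i\<in>UNIV. (y $ i) ^ m i))"
    using P unfolding polynomial_in_y_def by blast
  have const: "T (\<lambda>z. r)" for r using coeff[OF smooth_on_const] .
  have pow: "T (\<lambda>z. (snd z $ i) ^ k)" for i k
    by (induction k) (auto simp: const intro: mult coord)
  have prod: "T (\<lambda>z. \<Prod>i\<in>S. (snd z $ i) ^ m i)" if "finite S" for S m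
    using that by induction (auto simp: const intro: mult pow)
  have "T (\<lambda>z. \<Sum>m\<in>I. c m (fst z) * (\<Prod>i\<in>UNIV. (snd z $ i) ^ m i))"
    using I by induction (auto simp: const intro!: add mult prod coeff)
  then show ?thesis by (rule cong) (use Pc in auto)
qed

text \<open>The sum and product rules require differentiability, and the product rule returns the
  undifferentiated factors, so the three claims go through the induction together. The direction
  \<open>v\<close> covers base and fibre derivatives at once.\<close>

lemma polynomial_in_y_derivative:
  assumes V: "open V" and P: "polynomial_in_y V P"
  shows "(\<forall>z\<in>V \<times> UNIV. P differentiable (at z)) \<and> polynomial_in_y V P \<and>
    polynomial_in_y V (\<lambda>z. frechet_derivative P (at z) v)"
  using V P
proof (induction rule: polynomial_in_y_induct)
  case (coeff c)
  have D: "((\<lambda>z. c (fst z)) has_derivative (\<lambda>w. frechet_derivative c (at (fst z)) (fst w))) (at z)"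
    if "z \<in> V \<times> UNIV" for z
  proof -
    have "(c has_derivative frechet_derivative c (at (fst z))) (at (fst z))"
      using smooth_on_differentiable[OF coeff, of "fst z"] that
      by (auto simp: frechet_derivative_works[symmetric])
    from has_derivative_compose[OF has_derivative_fst[OF has_derivative_ident] this]
    show ?thesis .
  qed
  have "polynomial_in_y V (\<lambda>z. frechet_derivative (\<lambda>z. c (fst z)) (at z) v)"
  proof (rule polynomial_in_y_cong)
    show "polynomial_in_y V (\<lambda>z. frechet_derivative c (at (fst z)) (fst v))"
      by (rule polynomial_in_y_coeff[OF smooth_on_frechet_derivative[OF coeff]])
    show "frechet_derivative (\<lambda>z. c (fst z)) (at z) v = frechet_derivative c (at (fst z)) (fst v)"
      if "z \<in> V \<times> UNIV" for z
      using frechet_derivative_at[OF D[OF that]] by metis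
  qed
  then show ?case
    using differentiableI[OF D] polynomial_in_y_coeff[OF coeff] by blast
next
  case (coord i)
  have D: "((\<lambda>z. snd z $ i) has_derivative (\<lambda>w. snd w $ i)) (at z)"
    for z :: "(real ^ 'a) \<times> (real ^ 'a)"
    by (intro bounded_linear_imp_has_derivative bounded_linear_compose[OF bounded_linear_vec_nth]
        bounded_linear_snd)
  have "frechet_derivative (\<lambda>z. snd z $ i) (at z) v = snd v $ i" for z
    using frechet_derivative_at[OF D] by metis
  then show ?case
    using differentiableI[OF D] polynomial_in_y_coord by (auto simp: polynomial_in_y_const)
next
  case (add P Q)
  have "polynomial_in_y V (\<lambda>z. frechet_derivative (\<lambda>z. P z + Q z) (at z) v)"
  proof (rule polynomial_in_y_cong)
    show "polynomial_in_y V (\<lambda>z. frechet_derivative P (at z) v + frechet_derivative Q (at z) v)"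
      using add by (intro polynomial_in_y_add V) auto
    show "frechet_derivative (\<lambda>z. P z + Q z) (at z) v =
        frechet_derivative P (at z) v + frechet_derivative Q (at z) v" if "z \<in> V \<times> UNIV" for z
      using add that by (intro frechet_derivative_add_apply) blast+
  qed
  then show ?case using add polynomial_in_y_add[OF V] by (auto simp: differentiable_add)
next
  case (mult P Q)
  have "polynomial_in_y V (\<lambda>z. frechet_derivative (\<lambda>z. P z * Q z) (at z) v)"
  proof (rule polynomial_in_y_cong)
    show "polynomial_in_y V
        (\<lambda>z. P z * frechet_derivative Q (at z) v + frechet_derivative P (at z) v * Q z)"
      using mult by (intro polynomial_in_y_add polynomial_in_y_mult V) auto
    show "frechet_derivative (\<lambda>z. P z * Q z) (at z) v =
        P z * frechet_derivative Q (at z) v + frechet_derivative P (at z) v * Q z"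
      if "z \<in> V \<times> UNIV" for z
      using mult that by (intro frechet_derivative_mult_apply) blast+
  qed
  then show ?case using mult polynomial_in_y_mult[OF V] by (auto simp: differentiable_mult)
next
  case (cong P Q)
  have O: "open (V \<times> UNIV :: ((real ^ 'a) \<times> (real ^ 'a)) set)" using V by (simp add: open_Times)
  have "polynomial_in_y V (\<lambda>z. frechet_derivative Q (at z) v)"
    by (rule polynomial_in_y_cong[of _ "\<lambda>z. frechet_derivative P (at z) v"])
      (use cong frechet_derivative_cong_open[OF O _ cong(2)] in auto)
  moreover have "Q differentiable (at z)" if "z \<in> V \<times> UNIV" for z
    by (rule differentiable_cong_open[OF O that cong(2)]) (use cong(1) that in auto)
  moreover have "polynomial_in_y V Q"
    by (rule polynomial_in_y_cong[OF _ cong(2)]) (use cong(1) in auto)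
  ultimately show ?case by blast
qed


subsection \<open>Functions rational in the fibre coordinates\<close>

lemma open_slit: "open V \<Longrightarrow> open (slit V)"
  unfolding slit_def by (intro open_Times) (auto simp: open_delete)

lemma rational_in_yI:
  assumes "polynomial_in_y V P" "polynomial_in_y V Q"
    and "\<And>z. z \<in> slit V \<Longrightarrow> Q z \<noteq> 0" "\<And>z. z \<in> slit V \<Longrightarrow> f z = P z / Q z"
  shows "rational_in_y V f"
  using assms unfolding rational_in_y_def by blast

lemma rational_in_yE:
  assumes "rational_in_y V f"
  obtains P Q where "polynomial_in_y V P" "polynomial_in_y V Q"
    and "\<And>z. z \<in> slit V \<Longrightarrow> Q z \<noteq> 0" "\<And>z. z \<in> slit V \<Longrightarrow> f z = P z / Q z"
  using assms unfolding rational_in_y_def by blast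

lemma rational_in_y_cong:
  assumes "rational_in_y V f" "\<And>z. z \<in> slit V \<Longrightarrow> g z = f z"
  shows "rational_in_y V g"
  using assms(1) by (rule rational_in_yE) (rule rational_in_yI, auto simp: assms(2))

lemma polynomial_in_y_imp_rational: "polynomial_in_y V P \<Longrightarrow> rational_in_y V P"
  by (rule rational_in_yI[of _ _ "\<lambda>_. 1"]) (auto intro: polynomial_in_y_const)

lemma rational_in_y_const: "rational_in_y V (\<lambda>z. c)"
  by (intro polynomial_in_y_imp_rational polynomial_in_y_const)

lemma rational_in_y_coord: "rational_in_y V (\<lambda>z. snd z $ i)"
  by (intro polynomial_in_y_imp_rational polynomial_in_y_coord)

lemma rational_in_y_subset:
  assumes "rational_in_y V f" "W \<subseteq> V"
  shows "rational_in_y W f"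
proof -
  have "polynomial_in_y W P" if "polynomial_in_y V P" for P
  proof -
    obtain I c where I: "finite I" "\<forall>m\<in>I. smooth_on V (c m)"
      and "\<forall>x\<in>V. \<forall>y. P (x, y) = (\<Sum>m\<in>I. c m x * (\<Prod>i\<in>UNIV. (y $ i) ^ m i))"
      using \<open>polynomial_in_y V P\<close> unfolding polynomial_in_y_def by blast
    then have "\<forall>x\<in>W. \<forall>y. P (x, y) = (\<Sum>m\<in>I. c m x * (\<Prod>i\<in>UNIV. (y $ i) ^ m i))"
      using assms(2) by auto
    moreover have "\<forall>m\<in>I. smooth_on W (c m)"
      using I(2) smooth_on_subset[OF _ assms(2)] by blast
    ultimately show ?thesis using I(1) unfolding polynomial_in_y_def by blast
  qed
  moreover have "slit W \<subseteq> slit V" using assms(2) by (auto simp: slit_def)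
  ultimately show ?thesis using assms(1) unfolding rational_in_y_def by blast
qed

lemma rational_in_y_add:
  assumes V: "open V" and f: "rational_in_y V f" and g: "rational_in_y V g"
  shows "rational_in_y V (\<lambda>z. f z + g z)"
proof -
  obtain P Q where PQ: "polynomial_in_y V P" "polynomial_in_y V Q"
    "\<And>z. z \<in> slit V \<Longrightarrow> Q z \<noteq> 0" "\<And>z. z \<in> slit V \<Longrightarrow> f z = P z / Q z"
    using f by (rule rational_in_yE) blast
  obtain R S where RS: "polynomial_in_y V R" "polynomial_in_y V S"
    "\<And>z. z \<in> slit V \<Longrightarrow> S z \<noteq> 0" "\<And>z. z \<in> slit V \<Longrightarrow> g z = R z / S z"
    using g by (rule rational_in_yE) blast
  show ?thesis
    by (rule rational_in_yI[of _ "\<lambda>z. P z * S z + R z * Q z" "\<lambda>z. Q z * S z"])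
      (use PQ RS in \<open>auto intro!: polynomial_in_y_add polynomial_in_y_mult V simp: field_simps\<close>)
qed

lemma rational_in_y_mult:
  assumes V: "open V" and f: "rational_in_y V f" and g: "rational_in_y V g"
  shows "rational_in_y V (\<lambda>z. f z * g z)"
proof -
  obtain P Q where PQ: "polynomial_in_y V P" "polynomial_in_y V Q"
    "\<And>z. z \<in> slit V \<Longrightarrow> Q z \<noteq> 0" "\<And>z. z \<in> slit V \<Longrightarrow> f z = P z / Q z"
    using f by (rule rational_in_yE) blast
  obtain R S where RS: "polynomial_in_y V R" "polynomial_in_y V S"
    "\<And>z. z \<in> slit V \<Longrightarrow> S z \<noteq> 0" "\<And>z. z \<in> slit V \<Longrightarrow> g z = R z / S z"
    using g by (rule rational_in_yE) blast
  show ?thesis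
    by (rule rational_in_yI[of _ "\<lambda>z. P z * R z" "\<lambda>z. Q z * S z"])
      (use PQ RS in \<open>auto intro!: polynomial_in_y_mult V\<close>)
qed

lemma rational_in_y_diff:
  assumes "open V" "rational_in_y V f" "rational_in_y V g"
  shows "rational_in_y V (\<lambda>z. f z - g z)"
  using rational_in_y_add[OF assms(1,2) rational_in_y_mult[OF assms(1) rational_in_y_const[of V "-1"] assms(3)]]
  by simp

lemma rational_in_y_divide:
  assumes V: "open V" and f: "rational_in_y V f" and g: "rational_in_y V g"
    and nz: "\<And>z. z \<in> slit V \<Longrightarrow> g z \<noteq> 0"
  shows "rational_in_y V (\<lambda>z. f z / g z)"
proof -
  obtain R S where RS: "polynomial_in_y V R" "polynomial_in_y V S"
    "\<And>z. z \<in> slit V \<Longrightarrow> S z \<noteq> 0" "\<And>z. z \<in> slit V \<Longrightarrow> g z = R z / S z"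
    using g by (rule rational_in_yE) blast
  \<comment> \<open>The old numerator \<open>R\<close> can serve as denominator: it has no zero on
    the slit bundle because \<open>g\<close> has none.\<close>
  have "rational_in_y V (\<lambda>z. S z / R z)"
    by (rule rational_in_yI[OF RS(2,1)]) (use nz RS(4) in force)+
  from rational_in_y_mult[OF V f this] show ?thesis
    by (rule rational_in_y_cong) (use RS in simp)
qed

lemma rational_in_y_sum:
  assumes "open V" "\<And>s. s \<in> S \<Longrightarrow> rational_in_y V (f s)"
  shows "rational_in_y V (\<lambda>z. \<Sum>s\<in>S. f s z)"
  using assms(2)
  by (induction S rule: infinite_finite_induct)
    (auto simp: rational_in_y_const rational_in_y_add[OF assms(1)])

lemma rational_in_y_prod:
  assumes "open V" "\<And>s. s \<in> S \<Longrightarrow> rational_in_y V (f s)"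
  shows "rational_in_y V (\<lambda>z. \<Prod>s\<in>S. f s z)"
  using assms(2)
  by (induction S rule: infinite_finite_induct)
    (auto simp: rational_in_y_const rational_in_y_mult[OF assms(1)])

lemma rational_in_y_det:
  fixes B :: "(real ^ 'n::finite) \<times> (real ^ 'n) \<Rightarrow> real ^ 'm ^ 'm::finite"
  assumes "open V" "\<And>i j. rational_in_y V (\<lambda>z. B z $ i $ j)"
  shows "rational_in_y V (\<lambda>z. det (B z))"
  unfolding det_def
  by (intro rational_in_y_sum rational_in_y_mult rational_in_y_prod rational_in_y_const assms)

lemma rational_in_y_differentiable:
  assumes V: "open V" and f: "rational_in_y V f" and z: "z \<in> slit V"
  shows "f differentiable (at z)"
proof -
  obtain P Q where PQ: "polynomial_in_y V P" "polynomial_in_y V Q"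
    "\<And>z. z \<in> slit V \<Longrightarrow> Q z \<noteq> 0" "\<And>z. z \<in> slit V \<Longrightarrow> f z = P z / Q z"
    using f by (rule rational_in_yE) blast
  have zV: "z \<in> V \<times> UNIV" using z by (auto simp: slit_def)
  have "(\<lambda>z. P z / Q z) differentiable (at z)"
    using polynomial_in_y_derivative[OF V PQ(1)] polynomial_in_y_derivative[OF V PQ(2)] zV PQ(3)[OF z]
    by (intro differentiable_divide) auto
  then show ?thesis
    by (rule differentiable_cong_open[OF open_slit[OF V] z, rotated]) (simp add: PQ(4))
qed

text \<open>Differentiating \<open>P = f * Q\<close> and solving for the derivative of
  \<open>f\<close> gives the quotient rule in the form \<open>(P' - f * Q') / Q\<close>, which is
  rational because \<open>f\<close> is.\<close>

lemma rational_in_y_derivative: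
  assumes V: "open V" and f: "rational_in_y V f"
  shows "rational_in_y V (\<lambda>z. frechet_derivative f (at z) v)"
proof -
  obtain P Q where PQ: "polynomial_in_y V P" "polynomial_in_y V Q"
    "\<And>z. z \<in> slit V \<Longrightarrow> Q z \<noteq> 0" "\<And>z. z \<in> slit V \<Longrightarrow> f z = P z / Q z"
    using f by (rule rational_in_yE) blast
  have P': "\<forall>z\<in>V \<times> UNIV. P differentiable (at z)"
      "polynomial_in_y V (\<lambda>z. frechet_derivative P (at z) v)"
    and Q': "\<forall>z\<in>V \<times> UNIV. Q differentiable (at z)"
      "polynomial_in_y V (\<lambda>z. frechet_derivative Q (at z) v)"
    using polynomial_in_y_derivative[OF V] PQ(1,2) by blast+
  have "rational_in_y V (\<lambda>z.
      (frechet_derivative P (at z) v - f z * frechet_derivative Q (at z) v) / Q z)"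
    by (intro rational_in_y_divide rational_in_y_diff rational_in_y_mult V f
        polynomial_in_y_imp_rational PQ P' Q')
  then show ?thesis
  proof (rule rational_in_y_cong)
    fix z assume z: "z \<in> slit V"
    then have zV: "z \<in> V \<times> UNIV" by (auto simp: slit_def)
    have "frechet_derivative P (at z) = frechet_derivative (\<lambda>z. f z * Q z) (at z)"
      using PQ(3,4) by (intro frechet_derivative_cong_open[OF open_slit[OF V] z]) simp
    then have "frechet_derivative P (at z) v =
        f z * frechet_derivative Q (at z) v + frechet_derivative f (at z) v * Q z"
      by (simp only: frechet_derivative_mult_apply[OF rational_in_y_differentiable[OF V f z] bspec[OF Q'(1) zV]])
    then show "frechet_derivative f (at z) v =
        (frechet_derivative P (at z) v - f z * frechet_derivative Q (at z) v) / Q z"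
      using PQ(3)[OF z] by simp
  qed
qed

lemma rational_in_y_dx: "open V \<Longrightarrow> rational_in_y V f \<Longrightarrow> rational_in_y V (dx i f)"
  unfolding dx_def [abs_def] by (rule rational_in_y_derivative)

lemma rational_in_y_dy: "open V \<Longrightarrow> rational_in_y V f \<Longrightarrow> rational_in_y V (dy i f)"
  unfolding dy_def [abs_def] by (rule rational_in_y_derivative)

lemma matrix_mul_matrix_inv: "invertible M \<Longrightarrow> M ** matrix_inv M = mat 1"
  unfolding invertible_def matrix_inv_def by (rule someI2_ex) auto

text \<open>By Cramer's rule each component of the solution is a quotient of determinants, and
  determinants are polynomial in the matrix entries. This yields the rationality of the spray
  without computing an inverse matrix.\<close>

lemma rational_in_y_linear_solution:
  fixes B :: "(real ^ 'n::finite) \<times> (real ^ 'n) \<Rightarrow> real ^ 'm ^ 'm::finite"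
  assumes V: "open V" and B: "\<And>i j. rational_in_y V (\<lambda>z. B z $ i $ j)"
    and q: "\<And>i. rational_in_y V (\<lambda>z. q z $ i)"
    and det: "\<And>z. z \<in> slit V \<Longrightarrow> det (B z) \<noteq> 0"
    and s: "\<And>z. z \<in> slit V \<Longrightarrow> B z *v s z = q z"
  shows "rational_in_y V (\<lambda>z. s z $ k)"
proof -
  have "rational_in_y V (\<lambda>z. det (\<chi> i j. if j = k then q z $ i else B z $ i $ j) / det (B z))"
  proof (intro rational_in_y_divide rational_in_y_det V B det)
    show "rational_in_y V (\<lambda>z. (\<chi> i j. if j = k then q z $ i else B z $ i $ j) $ i $ j)" for i j
      using B q by (cases "j = k") auto
  qed
  then show ?thesis
  proof (rule rational_in_y_cong)
    fix z assume z: "z \<in> slit V"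
    have "s z = (\<chi> k. det (\<chi> i j. if j = k then q z $ i else B z $ i $ j) / det (B z))"
      using cramer[OF det[OF z]] s[OF z] by blast
    then show "s z $ k = det (\<chi> i j. if j = k then q z $ i else B z $ i $ j) / det (B z)"
      by simp
  qed
qed


subsection \<open>Homogeneous functions\<close>

text \<open>Expanding \<open>y\<close> in the standard basis and using linearity expresses the total
  derivative in a vertical direction through the partial derivatives \<open>dy\<close>.\<close>

lemma frechet_derivative_fibre:
  fixes f :: "(real ^ 'n::finite) \<times> (real ^ 'n) \<Rightarrow> real"
  assumes "f differentiable (at z)"
  shows "frechet_derivative f (at z) (0, y) = (\<Sum>i\<in>UNIV. y $ i * dy i f z)"
proof -
  interpret D: linear "frechet_derivative f (at z)"
    using linear_frechet_derivative[OF assms] .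
  have "y = (\<Sum>i\<in>UNIV. (y $ i) *\<^sub>R axis i 1)"
    using basis_expansion[of y] by (simp add: scalar_mult_eq_scaleR)
  then have "(0, y) = (\<Sum>i\<in>UNIV. (y $ i) *\<^sub>R (0 :: real ^ 'n, axis i 1 :: real ^ 'n))"
    by (simp add: prod_eq_iff fst_sum snd_sum)
  then show ?thesis by (simp only: D.sum D.scale dy_def real_scaleR_def)
qed

text \<open>The function \<open>t \<mapsto> f (x, t *\<^sub>R y)\<close> is differentiated at
  \<open>t = 1\<close> in two ways, by the chain rule and by homogeneity; uniqueness of the
  derivative gives Euler's relation.\<close>

lemma euler_homogeneous:
  fixes f :: "(real ^ 'n::finite) \<times> (real ^ 'n) \<Rightarrow> real"
  assumes d: "f differentiable (at (x, y))"
    and h: "\<And>t. t > 0 \<Longrightarrow> f (x, t *\<^sub>R y) = t ^ k * f (x, y)"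
  shows "(\<Sum>i\<in>UNIV. y $ i * dy i f (x, y)) = real k * f (x, y)"
proof -
  let ?D = "frechet_derivative f (at (x, y))"
  have "((\<lambda>t::real. (x, t *\<^sub>R y)) has_derivative (\<lambda>s. (0, s *\<^sub>R y))) (at 1)"
    by (auto intro!: derivative_eq_intros)
  moreover have "(f has_derivative ?D) (at ((\<lambda>t::real. (x, t *\<^sub>R y)) 1))"
    using d by (simp add: frechet_derivative_works)
  ultimately have 1: "((\<lambda>t::real. f (x, t *\<^sub>R y)) has_derivative (\<lambda>s. ?D (0, s *\<^sub>R y))) (at 1)"
    by (rule has_derivative_compose)
  have "((\<lambda>t::real. t ^ k * f (x, y)) has_derivative (\<lambda>s. s * (real k * f (x, y)))) (at 1)"
    by (auto intro!: derivative_eq_intros)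
  \<comment> \<open>Homogeneity is available for positive \<open>t\<close> only, so the comparison
    is made on the neighbourhood \<open>{0<..}\<close> of \<open>1\<close>.\<close>
  then have 2: "((\<lambda>t::real. f (x, t *\<^sub>R y)) has_derivative (\<lambda>s. s * (real k * f (x, y)))) (at 1)"
    by (rule has_derivative_transform_within_open[of _ _ _ _ "{0<..}"]) (auto simp: h)
  have "(\<lambda>s. ?D (0, s *\<^sub>R y)) = (\<lambda>s. s * (real k * f (x, y)))"
    using has_derivative_unique[OF 1 2] .
  from fun_cong[OF this, of 1] show ?thesis by (simp add: frechet_derivative_fibre[OF d])
qed

text \<open>Composing \<open>f\<close> with the fibre scaling \<open>?s\<close> and applying the
  chain rule produces a factor \<open>t\<close> in vertical directions. Cancelling it lowers the
  degree of homogeneity by one.\<close>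

lemma dy_homogeneous:
  fixes f :: "(real ^ 'n::finite) \<times> (real ^ 'n) \<Rightarrow> real"
  assumes V: "open V" and d: "\<And>z. z \<in> slit V \<Longrightarrow> f differentiable (at z)"
    and h: "\<And>x y. x \<in> V \<Longrightarrow> y \<noteq> 0 \<Longrightarrow> f (x, t *\<^sub>R y) = t ^ Suc k * f (x, y)"
    and z: "x \<in> V" "y \<noteq> 0" and t: "t > 0"
  shows "dy i f (x, t *\<^sub>R y) = t ^ k * dy i f (x, y)"
proof -
  let ?s = "\<lambda>w :: (real ^ 'n) \<times> (real ^ 'n). (fst w, t *\<^sub>R snd w)"
  have zs: "(x, y) \<in> slit V" "(x, t *\<^sub>R y) \<in> slit V" using z t by (auto simp: slit_def)
  have "(?s has_derivative ?s) (at (x, y))"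
    by (auto intro!: derivative_eq_intros)
  moreover have "(f has_derivative frechet_derivative f (at (x, t *\<^sub>R y))) (at (?s (x, y)))"
    using d[OF zs(2)] by (simp add: frechet_derivative_works)
  ultimately have 1: "((\<lambda>w. f (?s w)) has_derivative
      (\<lambda>w. frechet_derivative f (at (x, t *\<^sub>R y)) (?s w))) (at (x, y))"
    by (rule has_derivative_compose)
  have "((\<lambda>w. t ^ Suc k * f w) has_derivative (\<lambda>w. t ^ Suc k * frechet_derivative f (at (x, y)) w)) (at (x, y))"
    using d[OF zs(1)] by (intro has_derivative_mult_right) (simp add: frechet_derivative_works)
  then have 2: "((\<lambda>w. f (?s w)) has_derivative
      (\<lambda>w. t ^ Suc k * frechet_derivative f (at (x, y)) w)) (at (x, y))"
    by (rule has_derivative_transform_within_open[OF _ open_slit[OF V] zs(1)])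
      (simp add: slit_def mem_Times_iff h)
  have "frechet_derivative f (at (x, t *\<^sub>R y)) (?s (0, axis i 1)) =
      t ^ Suc k * frechet_derivative f (at (x, y)) (0, axis i 1)"
    using fun_cong[OF has_derivative_unique[OF 1 2]] .
  moreover have "frechet_derivative f (at (x, t *\<^sub>R y)) (?s (0, axis i 1)) =
      t * dy i f (x, t *\<^sub>R y)"
    using linear_scale[OF linear_frechet_derivative[OF d[OF zs(2)]], of t "(0, axis i 1)"]
    by (simp add: dy_def)
  ultimately show ?thesis using t by (simp add: dy_def)
qed


subsection \<open>Almost rational metrics in a chart\<close>

text \<open>The rationality argument is local: \<open>V\<close> stands for the image of one chart,
  \<open>F\<close> and \<open>E\<close> for the coordinate expressions of the metric and of
  \<open>\<eta>\<close>. The non-rationality of \<open>\<eta>\<close> enters only in the final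
  contradiction.\<close>

locale AR_chart =
  fixes V :: "(real ^ 'n::finite) set"
    and F E :: "(real ^ 'n) \<times> (real ^ 'n) \<Rightarrow> real"
    and a :: "(real ^ 'n) \<times> (real ^ 'n) \<Rightarrow> real ^ 'n ^ 'n"
  assumes V: "open V"
    and F_smooth: "smooth_on (slit V) F"
    and F_hom: "\<And>x y t. x \<in> V \<Longrightarrow> t > 0 \<Longrightarrow> F (x, t *\<^sub>R y) = t * F (x, y)"
    and g_pos: "\<And>z. z \<in> slit V \<Longrightarrow> pos_def (metric_tensor F z)"
    and g_eq: "\<And>z. z \<in> slit V \<Longrightarrow> metric_tensor F z = E z *\<^sub>R a z"
    and E_smooth: "smooth_on (slit V) E"
    and E_nonneg: "\<And>z. z \<in> slit V \<Longrightarrow> E z \<ge> 0"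
    and a_pos: "\<And>z. z \<in> slit V \<Longrightarrow> pos_def (a z)"
    and a_rat: "\<And>i j. rational_in_y V (\<lambda>z. a z $ i $ j)"
    and dx_ln_rat: "\<And>i. rational_in_y V (dx i (\<lambda>z. ln (E z)))"
begin

section \<open>Positivity and Euler's relations for the squared metric\<close>

abbreviation F2 :: "(real ^ 'n) \<times> (real ^ 'n) \<Rightarrow> real" where
  "F2 \<equiv> \<lambda>w. (F w)\<^sup>2"

text \<open>\<open>a_y\<close> and \<open>a_yy\<close> are the contractions of \<open>a\<close> with
  one and with two copies of \<open>y\<close>. Multiplied by \<open>E\<close>, they turn out to be
  half the fibre derivative of \<open>F2\<close> and \<open>F2\<close> itself.\<close>

definition a_y :: "'n \<Rightarrow> (real ^ 'n) \<times> (real ^ 'n) \<Rightarrow> real" where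
  "a_y j z = (\<Sum>i\<in>UNIV. a z $ i $ j * snd z $ i)"

definition a_yy :: "(real ^ 'n) \<times> (real ^ 'n) \<Rightarrow> real" where
  "a_yy z = (\<Sum>j\<in>UNIV. a_y j z * snd z $ j)"

lemma a_y_rat: "rational_in_y V (a_y j)"
  unfolding a_y_def [abs_def]
  by (intro rational_in_y_sum rational_in_y_mult V a_rat rational_in_y_coord)

lemma a_yy_rat: "rational_in_y V a_yy"
  unfolding a_yy_def [abs_def]
  by (intro rational_in_y_sum rational_in_y_mult V a_y_rat rational_in_y_coord)

text \<open>At a zero of \<open>E\<close> the metric tensor would be the zero matrix, which is not
  positive definite. Hence the logarithm of \<open>E\<close> is meaningful and \<open>E\<close> can
  be cancelled.\<close>

lemma E_pos: "z \<in> slit V \<Longrightarrow> E z > 0"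
proof -
  assume z: "z \<in> slit V"
  then have "snd z \<noteq> 0" by (auto simp: slit_def)
  then have "E z *\<^sub>R a z \<noteq> 0"
    using g_pos[OF z] unfolding g_eq[OF z] pos_def_def by fastforce
  then show ?thesis using E_nonneg[OF z] by (simp add: less_le)
qed

lemma a_yy_pos: "z \<in> slit V \<Longrightarrow> a_yy z > 0"
proof -
  assume z: "z \<in> slit V"
  then have "snd z \<noteq> 0" by (auto simp: slit_def)
  \<comment> \<open>The transpose appears because \<open>a_y\<close> contracts the first index of
    \<open>a\<close>; by symmetry it equals \<open>a z\<close>.\<close>
  then have "snd z \<bullet> (transpose (a z) *v snd z) > 0"
    using a_pos[OF z] by (simp add: pos_def_def)
  then show ?thesis
    by (simp add: a_yy_def a_y_def inner_vec_def matrix_vector_mult_def transpose_def mult.commute)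
qed

lemma det_a: "z \<in> slit V \<Longrightarrow> det (a z) \<noteq> 0"
proof -
  assume z: "z \<in> slit V"
  have "v = 0" if "a z *v v = 0" for v
    using a_pos[OF z] that unfolding pos_def_def by force
  then have "invertible (a z)"
    using matrix_left_invertible_ker[of "a z"] invertible_left_inverse[of "a z"] by blast
  then show ?thesis by (simp add: invertible_det_nz)
qed

lemma F2_smooth: "smooth_on (slit V) F2"
  unfolding power2_eq_square by (intro smooth_on_mult open_slit V F_smooth)

lemma dy_F2_differentiable: "z \<in> slit V \<Longrightarrow> dy j F2 differentiable (at z)"
  unfolding dy_def [abs_def]
  using smooth_on_differentiable[OF smooth_on_frechet_derivative[OF F2_smooth]] .

lemma F2_hom: "x \<in> V \<Longrightarrow> t > 0 \<Longrightarrow> F2 (x, t *\<^sub>R y) = t\<^sup>2 * F2 (x, y)"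
  by (simp add: F_hom power_mult_distrib)

text \<open>\<open>F2\<close> has degree two in the fibre, so \<open>dy j F2\<close> has degree one.
  Euler's relation recovers it from the fibre Hessian of \<open>F2\<close>, which is twice the
  metric tensor, that is \<open>2 * E z\<close> times \<open>a z\<close>.\<close>

lemma dy_F2:
  assumes z: "z \<in> slit V"
  shows "dy j F2 z = 2 * E z * a_y j z"
proof -
  obtain x y where xy: "z = (x, y)" "x \<in> V" "y \<noteq> 0" using z by (auto simp: slit_def)
  have "(\<Sum>i\<in>UNIV. y $ i * dy i (dy j F2) (x, y)) = real 1 * dy j F2 (x, y)"
  proof (rule euler_homogeneous)
    show "dy j F2 differentiable at (x, y)" using dy_F2_differentiable z xy by simp
    show "dy j F2 (x, t *\<^sub>R y) = t ^ 1 * dy j F2 (x, y)" if "t > 0" for t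
      by (rule dy_homogeneous[OF V smooth_on_differentiable[OF F2_smooth]])
        (use xy that F2_hom in \<open>auto simp: power2_eq_square\<close>)
  qed
  moreover have "dy i (dy j F2) z = 2 * E z * a z $ i $ j" for i
  proof -
    have "metric_tensor F z $ i $ j = (E z *\<^sub>R a z) $ i $ j" using g_eq[OF z] by simp
    then show ?thesis by (simp add: metric_tensor_def)
  qed
  ultimately show ?thesis
    using xy by (simp add: a_y_def sum_distrib_left mult_ac)
qed

text \<open>A second use of Euler's relation, now in degree two and with the first derivatives given
  by \<open>dy_F2\<close>.\<close>

lemma F2_eq:
  assumes z: "z \<in> slit V"
  shows "F2 z = E z * a_yy z"
proof -
  obtain x y where xy: "z = (x, y)" "x \<in> V" "y \<noteq> 0" using z by (auto simp: slit_def)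
  have "(\<Sum>i\<in>UNIV. y $ i * dy i F2 (x, y)) = real 2 * F2 (x, y)"
    by (rule euler_homogeneous)
      (use smooth_on_differentiable[OF F2_smooth z] xy F2_hom in auto)
  then have "2 * F2 z = (\<Sum>i\<in>UNIV. snd z $ i * (2 * E z * a_y i z))"
    using dy_F2[OF z] xy by simp
  also have "\<dots> = 2 * (E z * a_yy z)"
    by (simp add: a_yy_def sum_distrib_left mult_ac)
  finally show ?thesis by simp
qed

section \<open>Logarithmic derivatives of the factor \<open>E\<close>\<close>

lemma E_differentiable: "z \<in> slit V \<Longrightarrow> E differentiable (at z)"
  using smooth_on_differentiable[OF E_smooth] .

lemma derivative_E_mult:
  assumes f: "\<And>w. w \<in> slit V \<Longrightarrow> f w = E w * R w" and R: "rational_in_y V R" and z: "z \<in> slit V"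
  shows "frechet_derivative f (at z) v =
    E z * frechet_derivative R (at z) v + frechet_derivative E (at z) v * R z"
  using frechet_derivative_cong_open[OF open_slit[OF V] z f]
    frechet_derivative_mult_apply[OF E_differentiable[OF z] rational_in_y_differentiable[OF V R z]]
  by simp

text \<open>The chain rule for \<open>ln\<close>, valid as \<open>E\<close> is positive, turns the
  hypothesis on the base derivatives of \<open>ln (E z)\<close> into information about
  \<open>E\<close> itself.\<close>

lemma dx_E:
  assumes z: "z \<in> slit V"
  shows "dx i E z = E z * dx i (\<lambda>z. ln (E z)) z"
proof -
  have "((\<lambda>z. ln (E z)) has_derivative (\<lambda>v. frechet_derivative E (at z) v * inverse (E z))) (at z)"
    using E_differentiable[OF z] E_pos[OF z]
    by (auto intro!: derivative_eq_intros simp: frechet_derivative_works divide_inverse)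
  from fun_cong[OF frechet_derivative_at[OF this], of "(axis i 1, 0)"] show ?thesis
    using E_pos[OF z] by (simp add: dx_def field_simps)
qed

text \<open>On the slit bundle this is the fibre derivative of \<open>ln (E z)\<close>, written in
  terms of \<open>a\<close> alone so that its rationality is visible.\<close>

definition dy_ln :: "'n \<Rightarrow> (real ^ 'n) \<times> (real ^ 'n) \<Rightarrow> real" where
  "dy_ln i z = (2 * a_y i z - dy i a_yy z) / a_yy z"

lemma dy_ln_rat: "rational_in_y V (dy_ln i)"
  unfolding dy_ln_def [abs_def] using a_yy_pos
  by (intro rational_in_y_divide rational_in_y_diff rational_in_y_mult V rational_in_y_const
      a_y_rat a_yy_rat rational_in_y_dy) force

text \<open>The fibre derivative of \<open>F2\<close> is known in two forms: from
  \<open>dy_F2\<close>, and by the product rule from \<open>F2_eq\<close>. Equating them and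
  dividing by \<open>a_yy z\<close>, which is positive, isolates \<open>dy i E z\<close>.\<close>

lemma dy_E:
  assumes z: "z \<in> slit V"
  shows "dy i E z = E z * dy_ln i z"
proof -
  have "2 * E z * a_y i z = E z * dy i a_yy z + dy i E z * a_yy z"
    using dy_F2[OF z] derivative_E_mult[OF F2_eq a_yy_rat z] by (simp add: dy_def)
  then have "dy i E z * a_yy z = E z * (2 * a_y i z - dy i a_yy z)" by (simp add: algebra_simps)
  then show ?thesis using a_yy_pos[OF z] by (simp add: dy_ln_def field_simps)
qed

section \<open>Rationality of the spray and of the Ricci curvature\<close>

definition E_rational :: "((real ^ 'n) \<times> (real ^ 'n) \<Rightarrow> real) \<Rightarrow> bool" where
  "E_rational f \<longleftrightarrow> (\<exists>R. rational_in_y V R \<and> (\<forall>z\<in>slit V. f z = E z * R z))"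

text \<open>Differentiating \<open>E * R\<close> gives \<open>E\<close> times the sum of the
  derivative of \<open>R\<close> and \<open>R\<close> times the logarithmic derivative of
  \<open>E\<close>. Both summands are rational, so exactly one factor \<open>E\<close> survives
  however often one differentiates.\<close>

lemma E_rational_dx:
  assumes "E_rational f"
  shows "E_rational (dx i f)"
proof -
  obtain R where R: "rational_in_y V R" "\<And>z. z \<in> slit V \<Longrightarrow> f z = E z * R z"
    using assms unfolding E_rational_def by blast
  have "rational_in_y V (\<lambda>z. dx i R z + dx i (\<lambda>z. ln (E z)) z * R z)"
    by (intro rational_in_y_add rational_in_y_mult V R dx_ln_rat rational_in_y_dx)
  moreover have "dx i f z = E z * (dx i R z + dx i (\<lambda>z. ln (E z)) z * R z)" if "z \<in> slit V" for z
    \<comment> \<open>\<open>dx\<close> is unfolded only at \<open>f\<close>, \<open>R\<close> and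
      \<open>E\<close>, which keeps the derivative of \<open>ln (E z)\<close> in the form that
      \<open>dx_E\<close> provides.\<close>
    using derivative_E_mult[OF R(2,1) that] dx_E[OF that, of i]
    unfolding dx_def[of i f] dx_def[of i R] dx_def[of i E] by (simp add: algebra_simps)
  ultimately show ?thesis unfolding E_rational_def by blast
qed

lemma E_rational_dy:
  assumes "E_rational f"
  shows "E_rational (dy i f)"
proof -
  obtain R where R: "rational_in_y V R" "\<And>z. z \<in> slit V \<Longrightarrow> f z = E z * R z"
    using assms unfolding E_rational_def by blast
  have "rational_in_y V (\<lambda>z. dy i R z + dy_ln i z * R z)"
    by (intro rational_in_y_add rational_in_y_mult V R dy_ln_rat rational_in_y_dy)
  moreover have "dy i f z = E z * (dy i R z + dy_ln i z * R z)" if "z \<in> slit V" for z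
    using derivative_E_mult[OF R(2,1) that] dy_E[OF that, of i]
    unfolding dy_def by (simp add: algebra_simps)
  ultimately show ?thesis unfolding E_rational_def by blast
qed

lemma E_rational_F2: "E_rational F2"
  unfolding E_rational_def using a_yy_rat F2_eq by blast

text \<open>Up to the factor \<open>1 / 4\<close> the spray is the solution of a linear system whose
  matrix is \<open>E z\<close> times \<open>a z\<close> and whose right-hand side is
  \<open>E z\<close> times a rational vector. Cancelling \<open>E z\<close> leaves a system with
  rational data and nonzero determinant.\<close>

lemma spray_rat: "rational_in_y V (spray F i)"
proof -
  have "\<forall>r. \<exists>R. rational_in_y V R \<and> (\<forall>z\<in>slit V. dx r F2 z = E z * R z)"
    using E_rational_dx[OF E_rational_F2] unfolding E_rational_def by blast
  then obtain R where R: "\<And>r. rational_in_y V (R r)"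
    "\<And>r z. z \<in> slit V \<Longrightarrow> dx r F2 z = E z * R r z" by metis
  have "\<forall>r k. \<exists>S. rational_in_y V S \<and> (\<forall>z\<in>slit V. dy r (dx k F2) z = E z * S z)"
    using E_rational_dy[OF E_rational_dx[OF E_rational_F2]] unfolding E_rational_def by blast
  then obtain S where S: "\<And>r k. rational_in_y V (S r k)"
    "\<And>r k z. z \<in> slit V \<Longrightarrow> dy r (dx k F2) z = E z * S r k z" by metis
  \<comment> \<open>\<open>b\<close> is the bracket in the definition of the spray; \<open>q\<close>
    is the same expression with the factor \<open>E z\<close> removed.\<close>
  define b where "b = (\<lambda>z. \<chi> r. (\<Sum>k\<in>UNIV. snd z $ k * dy r (dx k F2) z) - dx r F2 z)"
  define q where "q = (\<lambda>z. \<chi> r. (\<Sum>k\<in>UNIV. snd z $ k * S r k z) - R r z)"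
  have "rational_in_y V (\<lambda>z. (matrix_inv (metric_tensor F z) *v b z) $ i)"
  proof (rule rational_in_y_linear_solution[OF V a_rat])
    show "rational_in_y V (\<lambda>z. q z $ r)" for r
      unfolding q_def vec_lambda_beta
      by (intro rational_in_y_diff rational_in_y_sum rational_in_y_mult rational_in_y_coord V R S)
    show "det (a z) \<noteq> 0" if "z \<in> slit V" for z using det_a[OF that] .
    show "a z *v (matrix_inv (metric_tensor F z) *v b z) = q z" if z: "z \<in> slit V" for z
    proof -
      have b: "b z = E z *\<^sub>R q z"
        using R(2)[OF z] S(2)[OF z]
        by (simp add: b_def q_def vec_eq_iff sum_distrib_left right_diff_distrib mult_ac)
      have "invertible (metric_tensor F z)"
        using det_a[OF z] E_pos[OF z] invertible_det_nz[of "a z"]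
        unfolding g_eq[OF z] by (simp add: scalar_invertible)
      then have "metric_tensor F z *v (matrix_inv (metric_tensor F z) *v b z) = b z"
        by (simp add: matrix_vector_mul_assoc matrix_mul_matrix_inv)
      then have "E z *\<^sub>R (a z *v (matrix_inv (metric_tensor F z) *v b z)) = E z *\<^sub>R q z"
        unfolding b[symmetric] by (simp add: g_eq[OF z] scaleR_matrix_vector_assoc)
      then show ?thesis using E_pos[OF z] by simp
    qed
  qed
  then have "rational_in_y V (\<lambda>z. 1 / 4 * (matrix_inv (metric_tensor F z) *v b z) $ i)"
    by (intro rational_in_y_mult V rational_in_y_const)
  then show ?thesis
    unfolding spray_def [abs_def] by (simp add: b_def matrix_vector_mult_def)
qed

text \<open>The curvature is built from the spray by derivatives, sums and products, all of which
  preserve rationality.\<close>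

lemma Ric_rat: "rational_in_y V (Ric F)"
  unfolding Ric_def [abs_def] riemann_curvature_def
  by (intro rational_in_y_add rational_in_y_diff rational_in_y_sum rational_in_y_mult
      rational_in_y_const rational_in_y_coord rational_in_y_dx rational_in_y_dy spray_rat V)

text \<open>Substituting \<open>F2_eq\<close> into the Einstein equation and dividing by
  \<open>K (fst z) * a_yy z\<close> exhibits \<open>E\<close> as a quotient of rational functions.
  Passing to \<open>W\<close> secures a denominator without zeros.\<close>

lemma E_rational_over:
  assumes W: "open W" "W \<subseteq> V" and K: "smooth_on W K" "\<And>x. x \<in> W \<Longrightarrow> K x \<noteq> 0"
    and Ric: "\<And>z. z \<in> slit W \<Longrightarrow> Ric F z = K (fst z) * F2 z"
  shows "rational_in_y W E"
proof -
  have sub: "z \<in> slit V" and fst: "fst z \<in> W" if "z \<in> slit W" for z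
    using that W(2) by (auto simp: slit_def)
  have nz: "K (fst z) * a_yy z \<noteq> 0" if "z \<in> slit W" for z
    using a_yy_pos[OF sub[OF that]] K(2)[OF fst[OF that]] by simp
  have "rational_in_y W (\<lambda>z. Ric F z / (K (fst z) * a_yy z))"
    by (intro rational_in_y_divide rational_in_y_mult nz polynomial_in_y_imp_rational
        polynomial_in_y_coeff K W rational_in_y_subset[OF Ric_rat] rational_in_y_subset[OF a_yy_rat])
  then show ?thesis
    by (rule rational_in_y_cong) (use nz Ric F2_eq sub in \<open>force simp: field_simps\<close>)
qed

end


section \<open>Vanishing of the Einstein function by contradiction\<close>

theorem theorem3p23:
  fixes A :: "('a::{t2_space, second_countable_topology}, 'n::finite) chart set"
    and F \<eta> :: "('a, 'n) tvec \<Rightarrow> real"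
    and a :: "('a, 'n) chart \<Rightarrow> (real ^ 'n) \<times> (real ^ 'n) \<Rightarrow> real ^ 'n ^ 'n"
  assumes "CARD('n) \<ge> 2"
    and "smooth_atlas A"
    and "AR_finsler A F \<eta> a"
    and "nowhere_rational_in_y A \<eta>"
    and "\<forall>c\<in>A. \<forall>i. rational_in_y (chart_img c) (dx i (\<lambda>z. ln (in_chart A c \<eta> z)))"
    and "einstein A F"
  shows "ricci_flat A F"
proof -
  obtain K where K: "smooth_function A K"
    and Ric: "\<And>c z. c \<in> A \<Longrightarrow> z \<in> slit (chart_img c) \<Longrightarrow> Ric (in_chart A c F) z =
      (real CARD('n) - 1) * K (chart_inv c (fst z)) * (in_chart A c F z)\<^sup>2"
    using assms(6) unfolding einstein_def by blast
  have "Ric (in_chart A c F) z = 0" if c: "c \<in> A" and z: "z \<in> slit (chart_img c)" for c z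
  proof (rule ccontr)
    assume nz: "Ric (in_chart A c F) z \<noteq> 0"
    interpret AR_chart "chart_img c" "in_chart A c F" "in_chart A c \<eta>" "a c"
    proof
      show "open (chart_img c)" using assms(2) c unfolding smooth_atlas_def by blast
      note AR = assms(3)[unfolded AR_finsler_def finsler_metric_def]
      note finsler = bspec[OF conjunct1[OF AR] c] and almost_rational = bspec[OF conjunct2[OF AR] c]
      from finsler show "smooth_on (slit (chart_img c)) (in_chart A c F)"
        and "\<And>x y t. x \<in> chart_img c \<Longrightarrow> t > 0 \<Longrightarrow> in_chart A c F (x, t *\<^sub>R y) = t * in_chart A c F (x, y)"
        and "\<And>z. z \<in> slit (chart_img c) \<Longrightarrow> pos_def (metric_tensor (in_chart A c F) z)"
        by blast+
      from almost_rational
      show "\<And>z. z \<in> slit (chart_img c) \<Longrightarrow> metric_tensor (in_chart A c F) z = in_chart A c \<eta> z *\<^sub>R a c z"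
        and "smooth_on (slit (chart_img c)) (in_chart A c \<eta>)"
        and "\<And>z. z \<in> slit (chart_img c) \<Longrightarrow> in_chart A c \<eta> z \<ge> 0"
        and "\<And>z. z \<in> slit (chart_img c) \<Longrightarrow> pos_def (a c z)"
        and "\<And>i j. rational_in_y (chart_img c) (\<lambda>z. a c z $ i $ j)"
        by blast+
      show "\<And>i. rational_in_y (chart_img c) (dx i (\<lambda>z. ln (in_chart A c \<eta> z)))"
        using assms(5) c by blast
    qed
    \<comment> \<open>The constant \<open>n - 1\<close> is absorbed into the Einstein function, so
      that the Ricci curvature is \<open>k\<close> times the squared metric in this chart.\<close>
    define k where "k = (\<lambda>x. (real CARD('n) - 1) * (K \<circ> chart_inv c) x)"
    define W where "W = {x \<in> chart_img c. k x \<noteq> 0}"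
    have k: "smooth_on (chart_img c) k"
      using K c unfolding k_def smooth_function_def
      by (intro smooth_on_mult V smooth_on_const) blast
    \<comment> \<open>Non-rationality of \<open>\<eta>\<close> is assumed over nonempty open sets;
      continuity of \<open>k\<close> makes \<open>W\<close> such a set once it has a point.\<close>
    have W: "open W"
      using continuous_open_preimage[OF smooth_on_continuous[OF k] V, of "- {0}"]
      by (simp add: W_def Int_def vimage_def open_Compl)
    have sub: "W \<subseteq> chart_img c" by (auto simp: W_def)
    \<comment> \<open>A nonzero Ricci curvature at \<open>z\<close> forces \<open>k\<close> to be
      nonzero at its base point.\<close>
    have "fst z \<in> W" using z nz Ric[OF c z] by (auto simp: W_def k_def slit_def)
    moreover have "rational_in_y W (in_chart A c \<eta>)"
    proof (rule E_rational_over[OF W sub smooth_on_subset[OF k sub]])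
      show "k x \<noteq> 0" if "x \<in> W" for x using that by (simp add: W_def)
      show "Ric (in_chart A c F) z = k (fst z) * (in_chart A c F z)\<^sup>2" if "z \<in> slit W" for z
        using that Ric[OF c, of z] by (auto simp: W_def k_def slit_def)
    qed
    ultimately show False
      using assms(4) W sub c unfolding nowhere_rational_in_y_def by blast
  qed
  then show ?thesis unfolding ricci_flat_def by blast
qed

end
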